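(* Let $n\ge 2$. Let $P\subseteq\mathbb{R}^n$ be a convex polytope with nonempty interior and let $K\subseteq\mathbb{R}^n$ be a compact convex set with nonempty interior. If $K\equiv_{\mathcal{L}_{\mathrm{aff}}}P$, then $K$ is a polytope affinely equivalent to $P$ (hence $K$ and $P$ are isomorphic as $\mathcal{L}_{\mathrm{aff}}$-structures). Consequently, two convex polytopes in $\mathbb{R}^n$ (with nonempty interior) are $\mathcal{L}_{\mathrm{aff}}$-elementarily equivalent if and only if they are affinely equivalent.
   Context: $\mathcal{L}_{\mathrm{aff}}$ is the first-order language (with equality) having one ternary relation symbol $B$ and one binary function symbol $C_\lambda$ for each real $\lambda\in[0,1]$. A convex set $K\subseteq\mathbb{R}^n$ is regarded as an $\mathcal{L}_{\mathrm{aff}}$-structure with universe $K$, where $C_\lambda(p,q)=(1-\lambda)p+\lambda q$ and $B(a,x,b)$ holds iff $x\in[a,b]$ (the closed segment). $\equiv_{\mathcal{L}}$ denotes elementary equivalence in the language $\mathcal{L}$. Two subsets of $\mathbb{R}^n$ are affinely equivalent if some affine bijection of $\mathbb{R}^n$ maps one onto the other. A convex polytope is the convex hull of finitely many points. *)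

theory Defs
  imports "HOL-Analysis.Analysis"
begin

typedef unit_coeff = "{0..1::real}"
  morphisms coeff_val Abs_unit_coeff
  by (rule exI[of _ 0]) simp

datatype laff_term =
    Var nat
  | Comb unit_coeff laff_term laff_term

datatype laff_form =
    Equal laff_term laff_term
  | Betw laff_term laff_term laff_term
  | Neg laff_form
  | Conj laff_form laff_form
  | Exists nat laff_form

primrec term_vars :: "laff_term \<Rightarrow> nat set" where
  "term_vars (Var i) = {i}"
| "term_vars (Comb l s t) = term_vars s \<union> term_vars t"

primrec free_vars :: "laff_form \<Rightarrow> nat set" where
  "free_vars (Equal s t) = term_vars s \<union> term_vars t"
| "free_vars (Betw s t u) = term_vars s \<union> term_vars t \<union> term_vars u"
| "free_vars (Neg p) = free_vars p"
| "free_vars (Conj p q) = free_vars p \<union> free_vars q"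
| "free_vars (Exists i p) = free_vars p - {i}"

definition laff_sentence :: "laff_form \<Rightarrow> bool" where
  "laff_sentence p \<longleftrightarrow> free_vars p = {}"

record 'a laff_struct =
  universe :: "'a set"
  interp_B :: "'a \<Rightarrow> 'a \<Rightarrow> 'a \<Rightarrow> bool"
  interp_C :: "unit_coeff \<Rightarrow> 'a \<Rightarrow> 'a \<Rightarrow> 'a"

primrec eval_term :: "'a laff_struct \<Rightarrow> (nat \<Rightarrow> 'a) \<Rightarrow> laff_term \<Rightarrow> 'a" where
  "eval_term M e (Var i) = e i"
| "eval_term M e (Comb l s t) = interp_C M l (eval_term M e s) (eval_term M e t)"

primrec sat :: "'a laff_struct \<Rightarrow> (nat \<Rightarrow> 'a) \<Rightarrow> laff_form \<Rightarrow> bool" where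
  "sat M e (Equal s t) \<longleftrightarrow> eval_term M e s = eval_term M e t"
| "sat M e (Betw s t u) \<longleftrightarrow>
     interp_B M (eval_term M e s) (eval_term M e t) (eval_term M e u)"
| "sat M e (Neg p) \<longleftrightarrow> \<not> sat M e p"
| "sat M e (Conj p q) \<longleftrightarrow> sat M e p \<and> sat M e q"
| "sat M e (Exists i p) \<longleftrightarrow> (\<exists>x\<in>universe M. sat M (e(i := x)) p)"

text \<open>For a sentence and a nonempty universe the choice of the assignment \<open>e\<close> is immaterial.\<close>

definition true_in :: "'a laff_struct \<Rightarrow> laff_form \<Rightarrow> bool" where
  "true_in M p \<longleftrightarrow> (\<forall>e. range e \<subseteq> universe M \<longrightarrow> sat M e p)"

definition elem_equiv :: "'a laff_struct \<Rightarrow> 'b laff_struct \<Rightarrow> bool" where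
  "elem_equiv M N \<longleftrightarrow> (\<forall>p. laff_sentence p \<longrightarrow> (true_in M p \<longleftrightarrow> true_in N p))"

definition laff_isomorphic :: "'a laff_struct \<Rightarrow> 'b laff_struct \<Rightarrow> bool" where
  "laff_isomorphic M N \<longleftrightarrow>
     (\<exists>f. bij_betw f (universe M) (universe N) \<and>
       (\<forall>a\<in>universe M. \<forall>x\<in>universe M. \<forall>b\<in>universe M.
          interp_B N (f a) (f x) (f b) \<longleftrightarrow> interp_B M a x b) \<and>
       (\<forall>l. \<forall>p\<in>universe M. \<forall>q\<in>universe M.
          f (interp_C M l p q) = interp_C N l (f p) (f q)))"

definition aff_struct :: "'a::real_vector set \<Rightarrow> 'a laff_struct" where
  "aff_struct K =
     \<lparr>universe = K,
      interp_B = (\<lambda>a x b. x \<in> closed_segment a b),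
      interp_C = (\<lambda>l p q. (1 - coeff_val l) *\<^sub>R p + coeff_val l *\<^sub>R q)\<rparr>"

definition affine_map :: "('a::real_vector \<Rightarrow> 'b::real_vector) \<Rightarrow> bool" where
  "affine_map f \<longleftrightarrow> (\<exists>h c. linear h \<and> f = (\<lambda>x. h x + c))"

definition affinely_equivalent :: "'a::real_vector set \<Rightarrow> 'a set \<Rightarrow> bool" where
  "affinely_equivalent S T \<longleftrightarrow> (\<exists>f :: 'a \<Rightarrow> 'a. affine_map f \<and> bij f \<and> f ` S = T)"

end

theory Submission
  imports Defs
begin

text \<open>Let \<open>P\<close> be the convex hull of \<open>v\<^sub>0, \<dots>, v\<^sub>m\<^sub>-\<^sub>1\<close> and let \<open>B\<close> be an affine basis among these points.
  The values of terms in the variables of \<open>B\<close> are exactly the points of the simplex spanned by \<open>B\<close>.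
  Moving from an interior point \<open>c\<close> of this simplex a little towards \<open>v\<^sub>i\<close> does not leave the simplex,
  so the position of \<open>v\<^sub>i\<close> relative to \<open>B\<close> is recorded by an equation \<open>C\<^sub>\<lambda>(c, v\<^sub>i) = s\<close>, with \<open>\<lambda> > 0\<close> and
  \<open>c\<close>, \<open>s\<close> terms over \<open>B\<close>. Hence one sentence states that there are points satisfying these
  equations among which all extreme points occur. In a compact convex \<open>K\<close> satisfying it, the
  witnesses are the image of the \<open>v\<^sub>i\<close> under an affine map, which maps \<open>P\<close> onto \<open>K\<close> by the
  Krein--Milman theorem and is bijective because \<open>K\<close> has interior points.\<close>

section \<open>Affine maps\<close>

lemma affine_map_combination:
  assumes "affine_map f" "u + v = 1"
  shows "f (u *\<^sub>R x + v *\<^sub>R y) = u *\<^sub>R f x + v *\<^sub>R f y"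
proof -
  obtain h c where h: "linear h" and f: "f = (\<lambda>x. h x + c)"
    using assms(1) unfolding affine_map_def by blast
  have "c = u *\<^sub>R c + v *\<^sub>R c"
    using assms(2) by (metis scaleR_add_left scaleR_one)
  then show ?thesis
    unfolding f by (simp add: linear_add[OF h] linear_scale[OF h] scaleR_add_right)
qed

lemma affine_map_convex_hull:
  assumes "affine_map f"
  shows "f ` (convex hull S) = convex hull (f ` S)"
proof -
  obtain h c where h: "linear h" and f: "f = (\<lambda>x. h x + c)"
    using assms unfolding affine_map_def by blast
  have "f ` X = (+) c ` h ` X" for X
    unfolding f image_image by (simp add: add.commute)
  then show ?thesis
    by (simp add: convex_hull_linear_image[OF h] convex_hull_translation)
qed

lemma affine_map_surj:
  fixes f :: "'a::real_vector \<Rightarrow> 'b::euclidean_space"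
  assumes "affine_map f" "interior (f ` S) \<noteq> {}"
  shows "surj f"
proof -
  have "affine (range f)"
    unfolding affine_def by (auto simp flip: affine_map_combination[OF assms(1)])
  then have "affine hull (f ` S) \<subseteq> range f"
    by (intro hull_minimal) auto
  then show ?thesis
    using affine_hull_nonempty_interior[OF assms(2)] by auto
qed

text \<open>In equal finite dimension a surjective linear part is injective.\<close>

lemma affine_map_surj_imp_bij:
  fixes f :: "'a::euclidean_space \<Rightarrow> 'a"
  assumes "affine_map f" "surj f"
  shows "bij f"
proof -
  obtain h c where h: "linear h" and f: "f = (\<lambda>x. h x + c)"
    using assms(1) unfolding affine_map_def by blast
  have "surj h"
    unfolding surj_def
  proof
    fix y
    obtain x where "y + c = f x"
      using assms(2) by (metis surjD)
    then show "\<exists>x. y = h x"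
      unfolding f by auto
  qed
  then have "inj h"
    using h linear_surjective_imp_injective by blast
  then have "inj f"
    unfolding f inj_def by simp
  then show ?thesis
    using assms(2) by (simp add: bij_def)
qed

lemma affine_map_inv:
  fixes f :: "'a::euclidean_space \<Rightarrow> 'a"
  assumes "affine_map f" "bij f"
  shows "affine_map (inv f)"
proof -
  obtain h c where h: "linear h" and f: "f = (\<lambda>x. h x + c)"
    using assms(1) unfolding affine_map_def by blast
  have inj: "inj h"
    using bij_is_inj[OF assms(2)] unfolding f inj_def by simp
  then have surj: "surj h"
    using h linear_injective_imp_surjective by blast
  have lin: "linear (inv h)"
    using inj_linear_imp_inv_linear[OF h inj] .
  have "inv f y = inv h y + inv h (- c)" for y
  proof (rule inv_f_eq[OF bij_is_inj[OF assms(2)]])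
    show "f (inv h y + inv h (- c)) = y"
      unfolding f by (simp add: linear_add[OF h] surj_f_inv_f[OF surj])
  qed
  then show ?thesis
    unfolding affine_map_def using lin by blast
qed

lemma affinely_equivalent_sym:
  fixes S T :: "'a::euclidean_space set"
  assumes "affinely_equivalent S T"
  shows "affinely_equivalent T S"
proof -
  obtain f :: "'a \<Rightarrow> 'a" where f: "affine_map f" "bij f" "f ` S = T"
    using assms unfolding affinely_equivalent_def by blast
  have "inv f ` T = S"
    unfolding f(3)[symmetric] using bij_is_inj[OF f(2)] by (auto simp: image_image)
  then show ?thesis
    unfolding affinely_equivalent_def using f affine_map_inv bij_imp_bij_inv by blast
qed

text \<open>Translating one point of \<open>B\<close> to the origin turns affine independence into
  linear independence, so a linear extension supplies the linear part.\<close>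

lemma affine_map_extend:
  assumes "\<not> affine_dependent B"
  obtains f where "affine_map f" "\<And>b. b \<in> B \<Longrightarrow> f b = g b"
proof (cases "B = {}")
  case True
  have "affine_map (\<lambda>x. 0 + 0)"
    unfolding affine_map_def using linear_zero by blast
  with True show ?thesis
    using that by blast
next
  case False
  then obtain a where a: "a \<in> B"
    by blast
  then have "independent ((\<lambda>x. - a + x) ` (B - {a}))"
    using assms affine_dependent_iff_dependent2 by blast
  then obtain h where h: "linear h"
    and eq: "\<forall>x \<in> (\<lambda>x. - a + x) ` (B - {a}). h x = g (a + x) - g a"
    using linear_independent_extend[of _ "\<lambda>x. g (a + x) - g a"] by blast
  \<comment> \<open>The constant is forced by \<open>f a = g a\<close>; the other values follow from
    \<open>h (b - a) = g b - g a\<close>.\<close>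
  define f where "f = (\<lambda>x. h x + (g a - h a))"
  have "affine_map f"
    unfolding affine_map_def f_def using h by blast
  moreover have "f b = g b" if "b \<in> B" for b
  proof (cases "b = a")
    case True
    then show ?thesis
      by (simp add: f_def)
  next
    case False
    then have "h (b - a) = g b - g a"
      using eq that by auto
    then show ?thesis
      by (simp add: f_def linear_diff[OF h] algebra_simps)
  qed
  ultimately show ?thesis
    using that by blast
qed

section \<open>Isomorphisms and elementary equivalence\<close>

text \<open>Assignments are transported along the isomorphism, by induction on terms and formulas.
  Closure under \<open>interp_C\<close> keeps term values in the universe, where the isomorphism
  conditions apply.\<close>

lemma laff_isomorphic_imp_elem_equiv:
  assumes iso: "laff_isomorphic M N"
    and closed: "\<And>l p q. p \<in> universe M \<Longrightarrow> q \<in> universe M \<Longrightarrow> interp_C M l p q \<in> universe M"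
  shows "elem_equiv M N"
proof -
  obtain f where bij: "bij_betw f (universe M) (universe N)"
    and B: "\<And>a x b. a \<in> universe M \<Longrightarrow> x \<in> universe M \<Longrightarrow> b \<in> universe M \<Longrightarrow>
      interp_B N (f a) (f x) (f b) \<longleftrightarrow> interp_B M a x b"
    and C: "\<And>l p q. p \<in> universe M \<Longrightarrow> q \<in> universe M \<Longrightarrow>
      f (interp_C M l p q) = interp_C N l (f p) (f q)"
    using iso unfolding laff_isomorphic_def by blast
  have dom: "eval_term M e t \<in> universe M" if "range e \<subseteq> universe M" for e t
    using that by (induction t) (auto intro: closed)
  have eval: "eval_term N (f \<circ> e) t = f (eval_term M e t)" if "range e \<subseteq> universe M" for e t
    using that by (induction t) (auto simp: C dom)
  have sat: "sat N (f \<circ> e) p \<longleftrightarrow> sat M e p" if "range e \<subseteq> universe M" for e p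
    using that
  proof (induction p arbitrary: e)
    case (Equal s t)
    then show ?case
      using dom bij_betw_imp_inj_on[OF bij] by (simp only: sat.simps eval inj_on_eq_iff)
  next
    case (Betw s t u)
    then show ?case
      by (simp only: sat.simps eval B dom)
  next
    case (Exists i p)
    have "sat N ((f \<circ> e)(i := f x)) p \<longleftrightarrow> sat M (e(i := x)) p" if "x \<in> universe M" for x
    proof -
      have "range (e(i := x)) \<subseteq> universe M"
        using that Exists.prems by auto
      from Exists.IH[OF this] show ?thesis
        by (simp only: fun_upd_comp)
    qed
    moreover have "universe N = f ` universe M"
      using bij by (simp add: bij_betw_def)
    ultimately show ?case
      by (simp del: comp_apply fun_upd_apply)
  qed simp_all
  have "true_in M p \<longleftrightarrow> true_in N p" for p
  proof
    assume L: "true_in M p"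
    show "true_in N p"
      unfolding true_in_def
    proof (intro allI impI)
      fix e :: "nat \<Rightarrow> _"
      assume e: "range e \<subseteq> universe N"
      \<comment> \<open>Since \<open>f\<close> is onto \<open>universe N\<close>, every assignment
        into \<open>N\<close> is the transport of one into \<open>M\<close>.\<close>
      define e' where "e' = inv_into (universe M) f \<circ> e"
      have "e i \<in> f ` universe M" for i
        using e bij by (auto simp: bij_betw_def)
      then have "range e' \<subseteq> universe M" "f \<circ> e' = e"
        by (auto simp: e'_def fun_eq_iff f_inv_into_f intro: inv_into_into)
      then show "sat N e p"
        using L sat unfolding true_in_def by metis
    qed
  next
    assume R: "true_in N p"
    show "true_in M p"
      unfolding true_in_def
    proof (intro allI impI)
      fix e :: "nat \<Rightarrow> _"
      assume e: "range e \<subseteq> universe M"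
      then have "range (f \<circ> e) \<subseteq> universe N"
        using bij by (auto simp: bij_betw_def)
      then show "sat M e p"
        using R sat[OF e] unfolding true_in_def by blast
    qed
  qed
  then show ?thesis
    unfolding elem_equiv_def by blast
qed

lemma affinely_equivalent_imp_laff_isomorphic:
  fixes S T :: "'a::real_vector set"
  assumes "affinely_equivalent S T"
  shows "laff_isomorphic (aff_struct S) (aff_struct T)"
proof -
  obtain f :: "'a \<Rightarrow> 'a" where f: "affine_map f" "bij f" "f ` S = T"
    using assms unfolding affinely_equivalent_def by blast
  have comb: "f ((1 - u) *\<^sub>R p + u *\<^sub>R q) = (1 - u) *\<^sub>R f p + u *\<^sub>R f q" for u p q
    by (simp add: affine_map_combination[OF f(1)])
  have "f x \<in> closed_segment (f a) (f b) \<longleftrightarrow> x \<in> closed_segment a b" for a x b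
    unfolding in_segment(1) comb[symmetric] using bij_is_inj[OF f(2)] by (auto simp: inj_eq)
  moreover have "bij_betw f S T"
    using f bij_betw_subset by blast
  ultimately show ?thesis
    unfolding laff_isomorphic_def aff_struct_def by (auto simp: comb intro!: exI[of _ f])
qed

lemma convex_coeff_comb:
  assumes "convex S" "p \<in> S" "q \<in> S"
  shows "(1 - coeff_val l) *\<^sub>R p + coeff_val l *\<^sub>R q \<in> S"
  using convexD_alt[OF assms] coeff_val[of l] by simp

lemma affinely_equivalent_imp_elem_equiv:
  assumes "affinely_equivalent S T" "convex S"
  shows "elem_equiv (aff_struct S) (aff_struct T)"
proof (rule laff_isomorphic_imp_elem_equiv)
  show "laff_isomorphic (aff_struct S) (aff_struct T)"
    using assms(1) by (rule affinely_equivalent_imp_laff_isomorphic)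
next
  fix l p q
  assume "p \<in> universe (aff_struct S)" "q \<in> universe (aff_struct S)"
  then show "interp_C (aff_struct S) l p q \<in> universe (aff_struct S)"
    using assms(2) by (simp add: aff_struct_def convex_coeff_comb)
qed

section \<open>Values of terms\<close>

lemma eval_term_cong:
  "(\<And>i. i \<in> term_vars t \<Longrightarrow> e i = e' i) \<Longrightarrow> eval_term M e t = eval_term M e' t"
  by (induction t) auto

text \<open>Affine maps commute with affine combinations, and \<open>interp_C\<close> is the same
  formula in every \<open>aff_struct\<close>.\<close>

lemma eval_term_affine_map:
  assumes "affine_map f" "\<And>i. i \<in> term_vars t \<Longrightarrow> f (e i) = e' i"
  shows "f (eval_term (aff_struct K) e t) = eval_term (aff_struct L) e' t"
  using assms(2) by (induction t) (auto simp: aff_struct_def affine_map_combination[OF assms(1)])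

text \<open>The values form a convex set because each coefficient in [0,1] has its own symbol;
  conversely, a convex set containing the points is closed under every \<open>Comb\<close>.\<close>

lemma convex_hull_eq_eval_term:
  "convex hull (e ` I) = {eval_term (aff_struct K) e t | t. term_vars t \<subseteq> I}" (is "?H = ?T")
proof
  show "?H \<subseteq> ?T"
  proof (rule hull_minimal)
    show "e ` I \<subseteq> ?T"
    proof (clarify)
      fix i
      assume "i \<in> I"
      then show "\<exists>t. e i = eval_term (aff_struct K) e t \<and> term_vars t \<subseteq> I"
        by (intro exI[of _ "Var i"]) simp
    qed
    show "convex ?T"
      unfolding convex_alt
    proof (clarify)
      fix s t and u :: real
      assume "term_vars s \<subseteq> I" "term_vars t \<subseteq> I" "0 \<le> u" "u \<le> 1"
      then show "\<exists>r. (1 - u) *\<^sub>R eval_term (aff_struct K) e s + u *\<^sub>R eval_term (aff_struct K) e t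
          = eval_term (aff_struct K) e r \<and> term_vars r \<subseteq> I"
        by (intro exI[of _ "Comb (Abs_unit_coeff u) s t"])
          (simp add: aff_struct_def Abs_unit_coeff_inverse)
    qed
  qed
  have "eval_term (aff_struct K) e t \<in> ?H" if "term_vars t \<subseteq> I" for t
    using that
  proof (induction t)
    case (Var i)
    then show ?case
      by (simp add: hull_inc)
  next
    case (Comb l s t)
    then show ?case
      using convex_convex_hull[of "e ` I"] by (auto simp: aff_struct_def intro: convex_coeff_comb)
  qed
  then show "?T \<subseteq> ?H"
    by blast
qed

text \<open>Positivity of the coefficient makes the equation solvable for \<open>e i\<close>, so
  that it determines this point from the points indexed by \<open>J\<close>.\<close>

lemma point_position_term_equation:
  fixes e :: "nat \<Rightarrow> 'a::euclidean_space"
  assumes "affine hull (e ` J) = UNIV"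
  obtains l c s where "coeff_val l > 0" "term_vars c \<subseteq> J" "term_vars s \<subseteq> J"
    "eval_term (aff_struct K) e (Comb l c (Var i)) = eval_term (aff_struct K) e s"
proof -
  let ?S = "convex hull (e ` J)"
  \<comment> \<open>With full affine hull the relative interior of the nonempty convex set
    \<open>?S\<close>, which is nonempty, is its interior.\<close>
  have "affine hull ?S = UNIV"
    using assms by simp
  then have "interior ?S \<noteq> {}"
    using rel_interior_interior[of ?S] rel_interior_eq_empty[of ?S] by force
  then obtain c r where cr: "r > 0" "ball c r \<subseteq> ?S"
    by (auto simp: mem_interior)
  \<comment> \<open>This bounds the displacement \<open>u * norm (e i - c)\<close> by
    \<open>r / 2\<close>; the cap 1 makes \<open>u\<close> a coefficient, and the summand 1 keeps
    the denominator positive when \<open>e i = c\<close>.\<close>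
  define u where "u = min 1 (r / (2 * (norm (e i - c) + 1)))"
  have n: "norm (e i - c) + 1 > 0"
    by (simp add: add_nonneg_pos)
  then have u: "0 < u" "u \<le> 1"
    using cr(1) by (auto simp: u_def)
  have "u * norm (e i - c) \<le> u * (norm (e i - c) + 1)"
    using u by (simp add: mult_left_mono)
  also have "\<dots> \<le> r / (2 * (norm (e i - c) + 1)) * (norm (e i - c) + 1)"
    using n by (intro mult_right_mono) (auto simp: u_def)
  also have "\<dots> = r / 2"
    using n by (simp add: field_simps)
  also have "\<dots> < r"
    using cr(1) by simp
  finally have "norm (u *\<^sub>R (e i - c)) < r"
    using u by simp
  moreover have "(1 - u) *\<^sub>R c + u *\<^sub>R e i = c + u *\<^sub>R (e i - c)"
    by (simp add: algebra_simps)
  ultimately have "(1 - u) *\<^sub>R c + u *\<^sub>R e i \<in> ball c r"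
    by (simp add: dist_norm)
  then have "(1 - u) *\<^sub>R c + u *\<^sub>R e i \<in> ?S" "c \<in> ?S"
    using cr by auto
  then obtain tc ts where "term_vars tc \<subseteq> J" "term_vars ts \<subseteq> J"
    "c = eval_term (aff_struct K) e tc"
    "(1 - u) *\<^sub>R c + u *\<^sub>R e i = eval_term (aff_struct K) e ts"
    unfolding convex_hull_eq_eval_term[of e J K] by auto
  then show ?thesis
    using u by (intro that[of "Abs_unit_coeff u" tc ts])
      (auto simp: aff_struct_def Abs_unit_coeff_inverse)
qed

section \<open>The characteristic sentence of a polytope\<close>

primrec Exists_below :: "nat \<Rightarrow> laff_form \<Rightarrow> laff_form" where
  "Exists_below 0 p = p"
| "Exists_below (Suc m) p = Exists_below m (Exists m p)"

lemma free_vars_Exists_below [simp]: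
  "free_vars (Exists_below m p) = free_vars p - {..<m}"
  by (induction m arbitrary: p) (auto simp: lessThan_Suc)

lemma sat_Exists_below:
  "sat M e (Exists_below m p) \<longleftrightarrow>
     (\<exists>w. (\<forall>i<m. w i \<in> universe M) \<and> (\<forall>i\<ge>m. w i = e i) \<and> sat M w p)"
proof (induction m arbitrary: p)
  case 0
  have "w = e \<longleftrightarrow> (\<forall>i. w i = e i)" for w
    by auto
  then show ?case
    by (simp flip: fun_eq_iff)
next
  case (Suc m)
  show ?case (is "_ \<longleftrightarrow> ?R")
  proof -
    have "?R" if "\<forall>i<m. w i \<in> universe M" "\<forall>i\<ge>m. w i = e i" "x \<in> universe M"
      "sat M (w(m := x)) p" for w x
      using that by (intro exI[of _ "w(m := x)"]) (auto simp del: fun_upd_apply simp: fun_upd_same fun_upd_other less_Suc_eq)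
    \<comment> \<open>Conversely, \<open>w m\<close> witnesses the inner quantifier, and resetting
      \<open>w\<close> at \<open>m\<close> to \<open>e m\<close> fits the outer block.\<close>
    moreover have "\<exists>w. (\<forall>i<m. w i \<in> universe M) \<and> (\<forall>i\<ge>m. w i = e i) \<and>
        (\<exists>x\<in>universe M. sat M (w(m := x)) p)"
      if "\<forall>i<Suc m. w i \<in> universe M" "\<forall>i\<ge>Suc m. w i = e i" "sat M w p" for w
      using that by (intro exI[of _ "w(m := e m)"] conjI bexI[of _ "w m"]) auto
    ultimately show ?thesis
      by (simp add: Suc.IH) blast
  qed
qed

text \<open>The language has no constant for truth, so the empty conjunction is a trivial equation.
  It leaves variable 0 free.\<close>

definition Conj_list :: "laff_form list \<Rightarrow> laff_form" where
  "Conj_list ps = foldr Conj ps (Equal (Var 0) (Var 0))"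

lemma free_vars_Conj_list:
  "free_vars (Conj_list ps) = insert 0 (\<Union>p\<in>set ps. free_vars p)"
  by (induction ps) (auto simp: Conj_list_def)

lemma sat_Conj_list [simp]:
  "sat M e (Conj_list ps) \<longleftrightarrow> (\<forall>p\<in>set ps. sat M e p)"
  by (induction ps) (auto simp: Conj_list_def)

text \<open>The two fresh variables are endpoints in the universe; the formula denies that variable
  \<open>k\<close> lies in their open segment.\<close>

definition extreme_form :: "nat \<Rightarrow> laff_form" where
  "extreme_form k = Neg (Exists (Suc k) (Exists (Suc (Suc k))
     (Conj (Betw (Var (Suc k)) (Var k) (Var (Suc (Suc k))))
       (Conj (Neg (Equal (Var k) (Var (Suc k)))) (Neg (Equal (Var k) (Var (Suc (Suc k)))))))))"

lemma free_vars_extreme_form: "free_vars (extreme_form k) = {k}"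
  by (auto simp: extreme_form_def)

lemma sat_extreme_form:
  assumes "e k \<in> K"
  shows "sat (aff_struct K) e (extreme_form k) \<longleftrightarrow> e k extreme_point_of K"
  using assms by (auto simp: extreme_form_def aff_struct_def extreme_point_of_def open_segment_def)

text \<open>Variables below \<open>m\<close> stand for candidate vertices. Variable
  \<open>m\<close>, outside that block, ranges over extreme points: none may differ from all
  candidates.\<close>

definition polytope_form :: "nat \<Rightarrow> (nat \<Rightarrow> laff_term) \<Rightarrow> (nat \<Rightarrow> laff_term) \<Rightarrow> laff_form" where
  "polytope_form m s t = Exists_below m (Conj
     (Neg (Exists m (Conj (extreme_form m)
       (Conj_list (map (\<lambda>i. Neg (Equal (Var m) (Var i))) [0..<m])))))
     (Conj_list (map (\<lambda>i. Equal (s i) (t i)) [0..<m])))"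

lemma laff_sentence_polytope_form:
  assumes "m > 0" "\<And>i. i < m \<Longrightarrow> term_vars (s i) \<subseteq> {..<m}" "\<And>i. i < m \<Longrightarrow> term_vars (t i) \<subseteq> {..<m}"
  shows "laff_sentence (polytope_form m s t)"
proof -
  have "(\<Union>i<m. term_vars (s i) \<union> term_vars (t i)) \<subseteq> {..<m}"
    using assms(2,3) by blast
  then have "(\<Union>p\<in>set (map (\<lambda>i. Equal (s i) (t i)) [0..<m]). free_vars p) \<subseteq> {..<m}"
    by (simp add: atLeast0LessThan)
  moreover have "(\<Union>p\<in>set (map (\<lambda>i. Neg (Equal (Var m) (Var i))) [0..<m]). free_vars p) - {m} \<subseteq> {..<m}"
    by auto
  \<comment> \<open>This binds the variable left free by the empty conjunction.\<close>
  moreover have "0 \<in> {..<m}"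
    using \<open>m > 0\<close> by simp
  ultimately show ?thesis
    unfolding laff_sentence_def polytope_form_def free_vars_Exists_below free_vars.simps
      free_vars_Conj_list free_vars_extreme_form Diff_eq_empty_iff
    by blast
qed

lemma sat_polytope_form:
  assumes "\<And>i. i < m \<Longrightarrow> term_vars (s i) \<subseteq> {..<m}" "\<And>i. i < m \<Longrightarrow> term_vars (t i) \<subseteq> {..<m}"
  shows "sat (aff_struct K) e (polytope_form m s t) \<longleftrightarrow>
    (\<exists>w. w ` {..<m} \<subseteq> K \<and> {x. x extreme_point_of K} \<subseteq> w ` {..<m} \<and>
      (\<forall>i<m. eval_term (aff_struct K) w (s i) = eval_term (aff_struct K) w (t i)))"
    (is "?L \<longleftrightarrow> (\<exists>w. ?R w)")
proof -
  have U: "universe (aff_struct K) = K"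
    by (simp add: aff_struct_def)
  have "sat (aff_struct K) (w(m := x)) (extreme_form m) \<longleftrightarrow> x extreme_point_of K"
    if "x \<in> K" for w x
    using sat_extreme_form[of "w(m := x)" m K] that by simp
  moreover have "x \<in> K" if "x extreme_point_of K" for x
    using that by (simp add: extreme_point_of_def)
  ultimately have ext: "\<not> (\<exists>x\<in>K. sat (aff_struct K) (w(m := x)) (extreme_form m) \<and> (\<forall>i<m. x \<noteq> w i))
      \<longleftrightarrow> {x. x extreme_point_of K} \<subseteq> w ` {..<m}" for w
    by (auto simp add: subset_iff image_iff Bex_def)
  have distinct: "sat (aff_struct K) (w(m := x)) (Conj_list (map (\<lambda>i. Neg (Equal (Var m) (Var i))) [0..<m]))
      \<longleftrightarrow> (\<forall>i<m. x \<noteq> w i)" for w x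
    by auto
  have eqs: "sat (aff_struct K) w (Conj_list (map (\<lambda>i. Equal (s i) (t i)) [0..<m])) \<longleftrightarrow>
      (\<forall>i<m. eval_term (aff_struct K) w (s i) = eval_term (aff_struct K) w (t i))" for w
    by auto
  have sub: "w ` {..<m} \<subseteq> K \<longleftrightarrow> (\<forall>i<m. w i \<in> K)" for w
    by auto
  have L: "?L \<longleftrightarrow> (\<exists>w. (\<forall>i\<ge>m. w i = e i) \<and> ?R w)"
    unfolding polytope_form_def sat_Exists_below sat.simps(3,4,5) U
    by (simp only: distinct eqs sub ext conj_ac)
  \<comment> \<open>The quantifier block yields only assignments equal to \<open>e\<close> from
    \<open>m\<close> on. Any \<open>w\<close> can be changed there, as the terms read only variables
    below \<open>m\<close>.\<close>
  have "\<exists>w'. (\<forall>i\<ge>m. w' i = e i) \<and> ?R w'" if w: "?R w" for w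
  proof (intro exI conjI)
    let ?w = "\<lambda>i. if i < m then w i else e i"
    show "\<forall>i\<ge>m. ?w i = e i"
      by simp
    have im: "?w ` {..<m} = w ` {..<m}"
      by auto
    show "?w ` {..<m} \<subseteq> K" "{x. x extreme_point_of K} \<subseteq> ?w ` {..<m}"
      unfolding im using w by auto
    have "eval_term (aff_struct K) ?w r = eval_term (aff_struct K) w r" if "term_vars r \<subseteq> {..<m}" for r
      using that by (intro eval_term_cong) auto
    then show "\<forall>i<m. eval_term (aff_struct K) ?w (s i) = eval_term (aff_struct K) ?w (t i)"
      using w assms by simp
  qed
  with L show ?thesis
    by blast
qed

section \<open>Recovering an affine bijection from elementary equivalence\<close>

lemma elem_equiv_polytope_imp_affinely_equivalent:
  fixes P K :: "'a::euclidean_space set"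
  assumes P: "polytope P" "interior P \<noteq> {}"
    and K: "compact K" "convex K" "interior K \<noteq> {}"
    and equiv: "elem_equiv (aff_struct K) (aff_struct P)"
  shows "affinely_equivalent P K"
proof -
  obtain V where V: "finite V" "P = convex hull V"
    using P(1) unfolding polytope_def by blast
  obtain m :: nat and v where v: "V = v ` {..<m}" "inj_on v {..<m}"
    using finite_imp_nat_seg_image_inj_on[OF V(1)] by (auto simp: lessThan_def)
  have "m > 0"
    using P(2) V v by (cases m) auto
  have "affine hull V = UNIV"
    using affine_hull_nonempty_interior[OF P(2)] by (simp add: V)
  then obtain B where B: "B \<subseteq> V" "\<not> affine_dependent B" "affine hull B = UNIV"
    using affine_basis_exists[of V] by auto
  then obtain J where J: "J \<subseteq> {..<m}" "B = v ` J"
    unfolding v(1) by (meson subset_imageE)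
  have "\<exists>l c s. coeff_val l > 0 \<and> term_vars c \<subseteq> J \<and> term_vars s \<subseteq> J \<and>
    eval_term (aff_struct P) v (Comb l c (Var i)) = eval_term (aff_struct P) v s" for i
    using point_position_term_equation[of v J P i] B(3) unfolding J(2) by metis
  then obtain l c s where l: "\<And>i. coeff_val (l i) > 0"
    and cs: "\<And>i. term_vars (c i) \<subseteq> J" "\<And>i. term_vars (s i) \<subseteq> J"
    and v_eq: "\<And>i. eval_term (aff_struct P) v (Comb (l i) (c i) (Var i)) =
      eval_term (aff_struct P) v (s i)"
    by metis
  define \<phi> where "\<phi> = polytope_form m (\<lambda>i. Comb (l i) (c i) (Var i)) s"
  have vars: "term_vars (Comb (l i) (c i) (Var i)) \<subseteq> {..<m}" "term_vars (s i) \<subseteq> {..<m}"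
    if "i < m" for i
    using that order_trans[OF cs(1) J(1)] order_trans[OF cs(2) J(1)] by simp_all
  have sentence: "laff_sentence \<phi>"
    unfolding \<phi>_def using \<open>m > 0\<close> vars by (rule laff_sentence_polytope_form)
  have sat_\<phi>: "sat (aff_struct L) e \<phi> \<longleftrightarrow>
    (\<exists>w. w ` {..<m} \<subseteq> L \<and> {x. x extreme_point_of L} \<subseteq> w ` {..<m} \<and>
      (\<forall>i<m. eval_term (aff_struct L) w (Comb (l i) (c i) (Var i)) =
        eval_term (aff_struct L) w (s i)))" for L :: "'a set" and e
    unfolding \<phi>_def using vars by (rule sat_polytope_form)
  \<comment> \<open>The vertices themselves witness the sentence in \<open>P\<close>: extreme points
    of a convex hull lie in the generating set.\<close>
  have "v ` {..<m} \<subseteq> P" "{x. x extreme_point_of P} \<subseteq> v ` {..<m}"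
    unfolding V(2) v(1)[symmetric] by (auto simp: hull_inc extreme_points_of_convex_hull)
  then have "true_in (aff_struct P) \<phi>"
    unfolding true_in_def sat_\<phi>
    by (intro allI impI exI[of _ v] conjI v_eq)
  then have true_K: "true_in (aff_struct K) \<phi>"
    using equiv sentence unfolding elem_equiv_def by blast
  \<comment> \<open>Truth of a sentence quantifies over assignments into \<open>K\<close>, so some
    assignment must be supplied; a constant one will do.\<close>
  obtain x where "x \<in> K"
    using K(3) interior_subset by blast
  then have "range (\<lambda>_ :: nat. x) \<subseteq> universe (aff_struct K)"
    by (simp add: aff_struct_def)
  then have "sat (aff_struct K) (\<lambda>_. x) \<phi>"
    using true_K unfolding true_in_def by blast
  then obtain w where w: "w ` {..<m} \<subseteq> K" "{x. x extreme_point_of K} \<subseteq> w ` {..<m}"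
    and w_eq: "\<And>i. i < m \<Longrightarrow> eval_term (aff_struct K) w (Comb (l i) (c i) (Var i)) =
      eval_term (aff_struct K) w (s i)"
    unfolding sat_\<phi> by blast
  have K_hull: "K = convex hull (w ` {..<m})"
  proof
    show "K \<subseteq> convex hull (w ` {..<m})"
      using Krein_Milman_Minkowski[OF K(1,2)] hull_mono[OF w(2)] by blast
    show "convex hull (w ` {..<m}) \<subseteq> K"
      using w(1) K(2) by (rule hull_minimal)
  qed
  \<comment> \<open>The map sends each basis point to the witness with the same index; injectivity
    of \<open>v\<close> makes that index unique.\<close>
  obtain f where f: "affine_map f" and "\<And>b. b \<in> B \<Longrightarrow> f b = (w \<circ> the_inv_into {..<m} v) b"
    using affine_map_extend[OF B(2)] by blast
  then have f_J: "f (v i) = w i" if "i \<in> J" for i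
    using that J v(2) by (auto simp: the_inv_into_f_f subset_iff)
  \<comment> \<open>Terms over \<open>J\<close> are carried by \<open>f\<close> from values at
    \<open>v\<close> to values at \<open>w\<close>. Applying \<open>f\<close> to the equation for
    \<open>v i\<close> and comparing with that for \<open>w i\<close> leaves
    \<open>f (v i) = w i\<close> after cancelling the positive coefficient.\<close>
  have f_v: "f (v i) = w i" if "i < m" for i
  proof -
    have J_terms: "f (eval_term (aff_struct P) v t) = eval_term (aff_struct K) w t"
      if "term_vars t \<subseteq> J" for t
      using that f_J by (intro eval_term_affine_map[OF f]) auto
    let ?c = "eval_term (aff_struct K) w (c i)" and ?l = "coeff_val (l i)"
    have "(1 - ?l) *\<^sub>R ?c + ?l *\<^sub>R f (v i) = f (eval_term (aff_struct P) v (Comb (l i) (c i) (Var i)))"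
      using J_terms[OF cs(1)[of i]] by (simp add: aff_struct_def affine_map_combination[OF f])
    also have "\<dots> = eval_term (aff_struct K) w (s i)"
      unfolding v_eq using cs(2) by (rule J_terms)
    also have "\<dots> = (1 - ?l) *\<^sub>R ?c + ?l *\<^sub>R w i"
      using w_eq[OF that] by (simp add: aff_struct_def)
    finally show ?thesis
      using l[of i] by simp
  qed
  have f_P: "f ` P = K"
    unfolding V(2) v(1) affine_map_convex_hull[OF f] K_hull image_image using f_v by simp
  \<comment> \<open>Interior points of the image \<open>K\<close> make \<open>f\<close> surjective,
    hence bijective.\<close>
  then have "bij f"
    using affine_map_surj_imp_bij[OF f] affine_map_surj[OF f, of P] K(3) by simp
  then show ?thesis
    unfolding affinely_equivalent_def using f f_P by blast
qed

theorem theorem6p3: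
  assumes "CARD('n::finite) \<ge> 2"
  shows "(\<forall>P K :: (real ^ 'n) set.
            polytope P \<and> interior P \<noteq> {} \<and>
            compact K \<and> convex K \<and> interior K \<noteq> {} \<and>
            elem_equiv (aff_struct K) (aff_struct P) \<longrightarrow>
              polytope K \<and> affinely_equivalent K P \<and>
              laff_isomorphic (aff_struct K) (aff_struct P)) \<and>
         (\<forall>P Q :: (real ^ 'n) set.
            polytope P \<and> interior P \<noteq> {} \<and> polytope Q \<and> interior Q \<noteq> {} \<longrightarrow>
              (elem_equiv (aff_struct P) (aff_struct Q) \<longleftrightarrow> affinely_equivalent P Q))"
proof (intro conjI allI impI; (elim conjE)?)
  fix P K :: "(real ^ 'n) set"
  assume P: "polytope P" "interior P \<noteq> {}"
    and K: "compact K" "convex K" "interior K \<noteq> {}"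
    and equiv: "elem_equiv (aff_struct K) (aff_struct P)"
  have PK: "affinely_equivalent P K"
    using elem_equiv_polytope_imp_affinely_equivalent[OF P K equiv] .
  then obtain f :: "real ^ 'n \<Rightarrow> real ^ 'n" where f: "affine_map f" "f ` P = K"
    unfolding affinely_equivalent_def by blast
  obtain V where "finite V" "P = convex hull V"
    using P(1) unfolding polytope_def by blast
  \<comment> \<open>\<open>K\<close> is the hull of the image of the finite set
    \<open>V\<close>.\<close>
  then show "polytope K"
    using f affine_map_convex_hull polytope_convex_hull finite_imageI by metis
  show KP: "affinely_equivalent K P"
    using PK by (rule affinely_equivalent_sym)
  then show "laff_isomorphic (aff_struct K) (aff_struct P)"
    by (rule affinely_equivalent_imp_laff_isomorphic)
next
  fix P Q :: "(real ^ 'n) set"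
  assume P: "polytope P" "interior P \<noteq> {}" and Q: "polytope Q" "interior Q \<noteq> {}"
  show "elem_equiv (aff_struct P) (aff_struct Q) \<longleftrightarrow> affinely_equivalent P Q"
  proof
    assume "elem_equiv (aff_struct P) (aff_struct Q)"
    \<comment> \<open>\<open>Q\<close> serves as the polytope and \<open>P\<close> as the compact
      convex set, which gives the equivalence in the reverse direction; symmetry turns it
      around.\<close>
    then show "affinely_equivalent P Q"
      using elem_equiv_polytope_imp_affinely_equivalent P Q polytope_imp_compact
        polytope_imp_convex affinely_equivalent_sym by blast
  next
    assume "affinely_equivalent P Q"
    then show "elem_equiv (aff_struct P) (aff_struct Q)"
      using affinely_equivalent_imp_elem_equiv polytope_imp_convex P(1) by blast
  qed
qed

end
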